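(* Let $d\ge2$ and let $\tau$ be the cyclic ordering of $T=2$ tasks. After $k=2n\ge 2$ iterations, $$\sup_{S\in\mathcal{S}_2}F_{\tau,S}(k)=\frac{1}{2e(k-1)}-\frac{1}{4e(k-1)^2}+O\!\left(\frac{1}{k^3}\right).$$
   Context: Let $d\ge 1$, $T\ge1$. A task is a pair $(X_m,y_m)$ with $X_m\in\mathbb{R}^{n_m\times d}$, $y_m\in\mathbb{R}^{n_m}$ and $\operatorname{rank}(X_m)<d$. $\mathcal{S}_T$ denotes the set of collections $S=\{(X_m,y_m)\}_{m=1}^T$ of $T$ tasks such that $\|X_m\|\le 1$ (spectral norm) for all $m$ and there exists $w\in\mathbb{R}^d$ with $\|w\|\le 1$ and $y_m=X_mw$ for all $m$. Given $S$ and an ordering $\tau:\mathbb{N}^+\to\{1,\dots,T\}$, the iterates are $w_0=0$ and $w_t=w_{t-1}+X_{\tau(t)}^+(y_{\tau(t)}-X_{\tau(t)}w_{t-1})$, with $A^+$ the Moore–Penrose pseudoinverse. The forgetting at iteration $k$ is $F_{\tau,S}(k)=\frac1k\sum_{t=1}^k\|X_{\tau(t)}w_k-y_{\tau(t)}\|^2$. The cyclic ordering is $\tau(t)=((t-1)\bmod T)+1$. *)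

theory Defs
  imports "Jordan_Normal_Form.DL_Rank" "Jordan_Normal_Form.Matrix"
begin

definition vnorm :: "real vec \<Rightarrow> real" where
  "vnorm v = sqrt (\<Sum>i<dim_vec v. (v $ i)^2)"

definition spec_norm :: "real mat \<Rightarrow> real" where
  "spec_norm X = Sup {vnorm (X *\<^sub>v v) | v. v \<in> carrier_vec (dim_col X) \<and> vnorm v \<le> 1}"

definition pinv :: "real mat \<Rightarrow> real mat" where
  "pinv A = (THE P. P \<in> carrier_mat (dim_col A) (dim_row A) \<and>
      A * P * A = A \<and> P * A * P = P \<and>
      transpose_mat (A * P) = A * P \<and> transpose_mat (P * A) = P * A)"

definition mrank :: "real mat \<Rightarrow> nat" where
  "mrank A = vec_space.rank (dim_row A) A"

type_synonym task = "real mat \<times> real vec"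

definition is_task :: "nat \<Rightarrow> task \<Rightarrow> bool" where
  "is_task d S \<longleftrightarrow> dim_col (fst S) = d \<and> dim_vec (snd S) = dim_row (fst S) \<and> mrank (fst S) < d"

definition collections :: "nat \<Rightarrow> nat \<Rightarrow> (nat \<Rightarrow> task) set" where
  "collections d T = {S. (\<forall>m\<in>{1..T}. is_task d (S m) \<and> spec_norm (fst (S m)) \<le> 1) \<and>
      (\<exists>w \<in> carrier_vec d. vnorm w \<le> 1 \<and> (\<forall>m\<in>{1..T}. snd (S m) = fst (S m) *\<^sub>v w))}"

definition cyclic :: "nat \<Rightarrow> nat \<Rightarrow> nat" where
  "cyclic T t = ((t - 1) mod T) + 1"

primrec iterate :: "nat \<Rightarrow> (nat \<Rightarrow> task) \<Rightarrow> (nat \<Rightarrow> nat) \<Rightarrow> nat \<Rightarrow> real vec" where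
  "iterate d S \<tau> 0 = 0\<^sub>v d"
| "iterate d S \<tau> (Suc t) =
     (let X = fst (S (\<tau> (Suc t))); y = snd (S (\<tau> (Suc t))); w = iterate d S \<tau> t
      in w + pinv X *\<^sub>v (y - X *\<^sub>v w))"

definition forgetting :: "nat \<Rightarrow> (nat \<Rightarrow> nat) \<Rightarrow> (nat \<Rightarrow> task) \<Rightarrow> nat \<Rightarrow> real" where
  "forgetting d \<tau> S k = (1 / real k) *
     (\<Sum>t=1..k. (vnorm (fst (S (\<tau> t)) *\<^sub>v iterate d S \<tau> k - snd (S (\<tau> t))))^2)"

end

theory Submission
  imports Defs "Jordan_Normal_Form.Gauss_Jordan_Elimination" "HOL-Analysis.L2_Norm"
    "HOL-Real_Asymp.Real_Asymp"
begin

text \<open>Write \<open>e t\<close> for the error of the iterate at time \<open>t\<close>. Each step applies to it the orthogonal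
  projection onto the null space of the current task, so after \<open>k = 2 n\<close> steps only the first task is
  forgotten and twice the forgetting is at most \<open>|e k|\<^sup>2 - |e (k + 1)|\<^sup>2\<close>. The sequence
  \<open>s t = |e (t + 1)|\<^sup>2\<close> is log-convex with \<open>s 0 \<le> 1\<close>; putting \<open>x = s k / s (k - 1)\<close> this gives
  \<open>s (k - 1) \<le> x ^ (k - 1)\<close>, hence \<open>s (k - 1) - s k \<le> x ^ (k - 1) * (1 - x)\<close>, which is largest at
  \<open>x = (k - 1) / k\<close>. Two lines in a plane with squared cosine \<open>(k - 1) / k\<close> attain this bound, so the
  supremum equals \<open>((k - 1) / k) ^ (k - 1) / (2 k)\<close>, which is then expanded.\<close>

section \<open>Log-convex sequences and the extremal value\<close>

text \<open>The substitution \<open>x = y * (m / (m + 1))\<close> moves the maximiser to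
  \<open>y = 1\<close> and reduces the claim to \<open>y ^ m * (1 + m * (1 - y)) \<le> 1\<close>.
  This follows from Bernoulli's inequality for \<open>1 / y\<close> combined with
  \<open>1 / y - 1 \<ge> 1 - y\<close>.\<close>

lemma power_times_one_minus_le:
  fixes x :: real
  assumes "m \<ge> 1" "0 \<le> x"
  shows "x ^ m * (1 - x) \<le> (real m / (real m + 1)) ^ m / (real m + 1)"
proof (cases "x = 0")
  case True
  then show ?thesis using assms by (simp add: power_0_left)
next
  case False
  define y where "y = x * (real m + 1) / real m"
  have y: "y > 0" and xy: "x = y * (real m / (real m + 1))"
    using False assms by (auto simp: y_def)
  have "1 / y - 1 \<ge> 1 - y"
    using y zero_le_power2[of "y - 1"] by (simp add: field_simps power2_eq_square)
  then have "real m * (1 / y - 1) \<ge> real m * (1 - y)"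
    by (intro mult_left_mono) auto
  moreover have "1 + real m * (1 / y - 1) \<le> (1 + (1 / y - 1)) ^ m"
    using y by (intro Bernoulli_inequality) auto
  ultimately have "1 + real m * (1 - y) \<le> 1 / y ^ m"
    by (simp add: power_one_over)
  then have *: "y ^ m * (1 + real m * (1 - y)) \<le> 1"
    using y by (simp add: field_simps)
  have "x ^ m * (1 - x) = y ^ m * (1 + real m * (1 - y)) * ((real m / (real m + 1)) ^ m / (real m + 1))"
  proof -
    have "1 - x = (1 + real m * (1 - y)) / (real m + 1)"
      unfolding xy by (simp add: field_simps)
    moreover have "x ^ m = y ^ m * (real m / (real m + 1)) ^ m"
      unfolding xy power_mult_distrib ..
    ultimately show ?thesis by simp
  qed
  also have "\<dots> \<le> 1 * ((real m / (real m + 1)) ^ m / (real m + 1))"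
    by (intro mult_right_mono * ) auto
  finally show ?thesis by simp
qed

text \<open>Log-convexity makes the ratios of consecutive terms nondecreasing, so for positive terms
  the ratio \<open>s (Suc t) / s t\<close> is at least the geometric mean of the \<open>t\<close>
  earlier ones, which is at least the \<open>t\<close>-th root of \<open>s t\<close> because
  \<open>s 0 \<le> 1\<close>. Raising to the power \<open>t\<close> and clearing denominators gives
  a form that also covers vanishing terms.\<close>

lemma log_convex_root_bound:
  fixes s :: "nat \<Rightarrow> real"
  assumes nonneg: "\<And>t. 0 \<le> s t" and "s 0 \<le> 1"
    and convex: "\<And>t. (s (Suc t))\<^sup>2 \<le> s t * s (Suc (Suc t))"
  shows "s t ^ Suc t \<le> s (Suc t) ^ t"
proof (induction t)
  case 0
  then show ?case using assms by simp
next
  case (Suc t)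
  let ?a = "s (Suc t)" and ?b = "s (Suc (Suc t))"
  show ?case
  proof (cases "?a = 0")
    case True
    then show ?thesis using nonneg by simp
  next
    case False
    then have a: "?a > 0" using nonneg[of "Suc t"] by simp
    \<comment> \<open>Convexity is raised to the power \<open>Suc t\<close> so that the induction
      hypothesis can replace \<open>s t ^ Suc t\<close> by \<open>?a ^ t\<close>; this factor then
      cancels.\<close>
    have "?a ^ t * ?a ^ Suc (Suc t) = (?a\<^sup>2) ^ Suc t"
      by (simp add: power_mult_distrib power2_eq_square)
    also have "\<dots> \<le> (s t * ?b) ^ Suc t"
      by (intro power_mono convex) auto
    also have "\<dots> = s t ^ Suc t * ?b ^ Suc t"
      by (rule power_mult_distrib)
    also have "\<dots> \<le> ?a ^ t * ?b ^ Suc t"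
      using nonneg by (intro mult_right_mono Suc.IH) auto
    finally show ?thesis using a by (simp del: power_Suc)
  qed
qed

lemma log_convex_decrement_le:
  fixes s :: "nat \<Rightarrow> real"
  assumes nonneg: "\<And>t. 0 \<le> s t" and "s 0 \<le> 1"
    and convex: "\<And>t. (s (Suc t))\<^sup>2 \<le> s t * s (Suc (Suc t))"
    and "m \<ge> 1"
  shows "s m - s (Suc m) \<le> (real m / (real m + 1)) ^ m / (real m + 1)"
proof (cases "s (Suc m) < s m")
  case False
  then have "s m - s (Suc m) \<le> 0" by simp
  also have "0 \<le> (real m / (real m + 1)) ^ m / (real m + 1)" by simp
  finally show ?thesis .
next
  case True
  define x where "x = s (Suc m) / s m"
  have a: "s m > 0" using True nonneg[of "Suc m"] by linarith
  have x: "0 \<le> x" "x < 1" and bx: "s (Suc m) = s m * x"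
    using a True nonneg[of "Suc m"] by (auto simp: x_def)
  \<comment> \<open>This is the root bound with \<open>s (Suc m)\<close> written as
    \<open>s m * x\<close>; cancelling \<open>s m ^ m\<close> leaves
    \<open>s m \<le> x ^ m\<close>.\<close>
  have "s m ^ m * s m \<le> s m ^ m * x ^ m"
    using log_convex_root_bound[of s m, OF assms(1-3)] unfolding bx
    by (simp add: power_mult_distrib mult.commute)
  then have "s m \<le> x ^ m" using a by simp
  then have "s m * (1 - x) \<le> x ^ m * (1 - x)"
    using x by (intro mult_right_mono) auto
  also have "\<dots> \<le> (real m / (real m + 1)) ^ m / (real m + 1)"
    using x assms(4) by (intro power_times_one_minus_le)
  finally show ?thesis by (simp add: bx algebra_simps)
qed

text \<open>An eventual bound becomes one for all \<open>n \<ge> N\<close> by enlarging the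
  constant: the finitely many indices below the threshold \<open>M\<close> are absorbed by adding
  their quotients \<open>\<bar>f n / g n\<bar>\<close>.\<close>

lemma bigo_sequentially_imp_bound:
  fixes f g :: "nat \<Rightarrow> real"
  assumes "f \<in> O(g)" and pos: "\<And>n. n \<ge> N \<Longrightarrow> g n > 0"
  shows "\<exists>C. \<forall>n\<ge>N. \<bar>f n\<bar> \<le> C * g n"
proof -
  obtain c where "eventually (\<lambda>n. norm (f n) \<le> c * norm (g n)) at_top"
    using assms(1) by (elim landau_o.bigE)
  then obtain M where M: "\<And>n. n \<ge> M \<Longrightarrow> \<bar>f n\<bar> \<le> c * \<bar>g n\<bar>"
    by (auto simp: eventually_at_top_linorder)
  define D where "D = \<bar>c\<bar> + (\<Sum>n<M. \<bar>f n / g n\<bar>)"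
  have "\<bar>f n\<bar> \<le> D * g n" if n: "n \<ge> N" for n
  proof (cases "n < M")
    case True
    have "\<bar>f n / g n\<bar> \<le> (\<Sum>n<M. \<bar>f n / g n\<bar>)"
      using True by (intro member_le_sum) auto
    then have "\<bar>f n / g n\<bar> \<le> D" by (simp add: D_def)
    then show ?thesis using pos[OF n] by (simp add: field_simps)
  next
    case False
    have "c \<le> D" 
      using abs_ge_self[of c] sum_nonneg[of "{..<M}" "\<lambda>n. \<bar>f n / g n\<bar>"] by (simp add: D_def)
    then have "c * g n \<le> D * g n" using pos[OF n] by (intro mult_right_mono) auto
    moreover have "\<bar>f n\<bar> \<le> c * g n" using M[of n] False pos[OF n] by simp
    ultimately show ?thesis by linarith
  qed
  then show ?thesis by blast
qed

lemma extremal_value_expansion: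
  "\<exists>C. \<forall>k\<ge>2. \<bar>((real k - 1) / real k) ^ (k - 1) / (2 * real k)
     - (1 / (2 * exp 1 * (real k - 1)) - 1 / (4 * exp 1 * (real k - 1)\<^sup>2))\<bar> \<le> C / real k ^ 3"
proof -
  \<comment> \<open>This is the error multiplied by \<open>exp 1\<close>, with the power written
    through \<open>exp\<close> and \<open>ln\<close> to make it expandable for
    \<open>real_asymp\<close>. The added 1 offsets the limit -1 of the logarithmic term, so that
    only rational coefficients have to cancel.\<close>
  define f where "f k = exp (1 + (real k - 1) * ln ((real k - 1) / real k)) / (2 * real k)
     - (1 / (2 * (real k - 1)) - 1 / (4 * (real k - 1)\<^sup>2))" for k :: nat
  have "f \<in> O(\<lambda>k. 1 / real k ^ 3)"
    unfolding f_def by real_asymp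
  then obtain C where C: "\<And>k. k \<ge> 2 \<Longrightarrow> \<bar>f k\<bar> \<le> C * (1 / real k ^ 3)"
    using bigo_sequentially_imp_bound[of f "\<lambda>k. 1 / real k ^ 3" 2] by auto
  have "\<bar>((real k - 1) / real k) ^ (k - 1) / (2 * real k)
     - (1 / (2 * exp 1 * (real k - 1)) - 1 / (4 * exp 1 * (real k - 1)\<^sup>2))\<bar> \<le> C / exp 1 / real k ^ 3"
    if k: "k \<ge> 2" for k
  proof -
    have "exp ((real k - 1) * ln ((real k - 1) / real k)) = ((real k - 1) / real k) ^ (k - 1)"
      using k exp_of_nat_mult[of "k - 1" "ln ((real k - 1) / real k)"] by simp
    moreover have "p / q - (1 / (2 * e * a) - 1 / (4 * e * a\<^sup>2)) = (e * p / q - (1 / (2 * a) - 1 / (4 * a\<^sup>2))) / e"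
      if "e \<noteq> 0" for p q a e :: real
      using that by (simp add: diff_divide_distrib ac_simps)
    ultimately have "((real k - 1) / real k) ^ (k - 1) / (2 * real k)
        - (1 / (2 * exp 1 * (real k - 1)) - 1 / (4 * exp 1 * (real k - 1)\<^sup>2)) = f k / exp 1"
      unfolding f_def exp_add by simp
    then show ?thesis
      using divide_right_mono[OF C[OF k], of "exp 1"] by (simp add: mult.commute)
  qed
  then show ?thesis by blast
qed

section \<open>Euclidean and spectral norm\<close>

lemma vnorm_eq_L2_set: "vnorm v = L2_set (($) v) {..<dim_vec v}"
  by (simp add: vnorm_def L2_set_def)

lemma vnorm_nonneg [simp]: "0 \<le> vnorm v"
  by (simp add: vnorm_def sum_nonneg)

lemma vnorm_sq: "(vnorm v)\<^sup>2 = v \<bullet> v"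
  by (simp add: vnorm_def scalar_prod_def sum_nonneg lessThan_atLeast0 power2_eq_square)

lemma scalar_prod_self_nonneg [simp]: "0 \<le> (v :: real vec) \<bullet> v"
  by (simp flip: vnorm_sq)

lemma scalar_prod_self_eq_0:
  fixes v :: "real vec"
  assumes "v \<bullet> v = 0" "i < dim_vec v"
  shows "v $ i = 0"
proof -
  have "(\<Sum>i\<in>{0..<dim_vec v}. v $ i * v $ i) = 0"
    using assms(1) by (simp add: scalar_prod_def)
  then have "\<forall>i\<in>{0..<dim_vec v}. v $ i * v $ i = 0"
    by (subst (asm) sum_nonneg_eq_0_iff) auto
  then show ?thesis using assms(2) by auto
qed

lemma scalar_prod_le_vnorm:
  fixes u v :: "real vec"
  assumes "dim_vec u = dim_vec v"
  shows "\<bar>u \<bullet> v\<bar> \<le> vnorm u * vnorm v"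
proof -
  have "\<bar>u \<bullet> v\<bar> \<le> (\<Sum>i<dim_vec v. \<bar>u $ i\<bar> * \<bar>v $ i\<bar>)"
    unfolding scalar_prod_def lessThan_atLeast0[symmetric]
    by (rule order_trans[OF sum_abs]) (simp add: abs_mult)
  also have "\<dots> \<le> vnorm u * vnorm v"
    unfolding vnorm_eq_L2_set assms by (rule L2_set_mult_ineq)
  finally show ?thesis .
qed

lemma scalar_prod_Cauchy_Schwarz:
  fixes u v :: "real vec"
  assumes "dim_vec u = dim_vec v"
  shows "(u \<bullet> v)\<^sup>2 \<le> (u \<bullet> u) * (v \<bullet> v)"
proof -
  have "(u \<bullet> v)\<^sup>2 \<le> (vnorm u * vnorm v)\<^sup>2"
    using scalar_prod_le_vnorm[OF assms] by (simp add: abs_le_square_iff[symmetric])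
  then show ?thesis by (simp add: power_mult_distrib vnorm_sq)
qed

lemma vnorm_smult: "vnorm (a \<cdot>\<^sub>v v) = \<bar>a\<bar> * vnorm v"
  by (simp add: vnorm_def power_mult_distrib real_sqrt_mult flip: sum_distrib_left)

text \<open>A real \<open>Sup\<close> bounds the members of its set only when the set is bounded
  above. Cauchy-Schwarz applied to each row gives the Frobenius norm as a bound.\<close>

lemma bdd_above_spec_norm:
  "bdd_above {vnorm (X *\<^sub>v v) | v. v \<in> carrier_vec (dim_col X) \<and> vnorm v \<le> 1}"
proof (rule bdd_aboveI)
  fix y
  assume "y \<in> {vnorm (X *\<^sub>v v) | v. v \<in> carrier_vec (dim_col X) \<and> vnorm v \<le> 1}"
  then obtain v where v: "v \<in> carrier_vec (dim_col X)" "vnorm v \<le> 1" and y: "y = vnorm (X *\<^sub>v v)"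
    by auto
  have "(row X i \<bullet> v)\<^sup>2 \<le> (vnorm (row X i))\<^sup>2" for i
  proof -
    have "\<bar>row X i \<bullet> v\<bar> \<le> vnorm (row X i) * vnorm v"
      using v by (intro scalar_prod_le_vnorm) simp
    also have "\<dots> \<le> vnorm (row X i) * 1"
      using v by (intro mult_left_mono) auto
    finally show ?thesis by (simp add: abs_le_square_iff[symmetric])
  qed
  then show "y \<le> sqrt (\<Sum>i<dim_row X. (vnorm (row X i))\<^sup>2)"
    unfolding y vnorm_def[of "X *\<^sub>v v"] by (auto intro!: sum_mono)
qed

lemma vnorm_mult_mat_vec_le:
  assumes "spec_norm X \<le> 1" "v \<in> carrier_vec (dim_col X)"
  shows "vnorm (X *\<^sub>v v) \<le> vnorm v"
proof (cases "vnorm v = 0")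
  case True
  then have "v \<bullet> v = 0" using vnorm_sq[of v] by simp
  then have "v = 0\<^sub>v (dim_col X)"
    using assms(2) by (intro eq_vecI) (auto intro: scalar_prod_self_eq_0)
  then have "X *\<^sub>v v = 0\<^sub>v (dim_row X)"
    by (intro eq_vecI) auto
  then show ?thesis by (simp add: vnorm_def sum_nonneg)
next
  case False
  then have pos: "vnorm v > 0" using vnorm_nonneg[of v] by linarith
  define u where "u = (1 / vnorm v) \<cdot>\<^sub>v v"
  have u: "u \<in> carrier_vec (dim_col X)" "vnorm u \<le> 1"
    using assms(2) pos by (auto simp: u_def vnorm_smult)
  have "vnorm (X *\<^sub>v u) \<le> spec_norm X"
    unfolding spec_norm_def using u by (intro cSup_upper bdd_above_spec_norm) auto
  moreover have "X *\<^sub>v u = (1 / vnorm v) \<cdot>\<^sub>v (X *\<^sub>v v)"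
    unfolding u_def using assms(2) by (intro mult_mat_vec) auto
  ultimately have "vnorm (X *\<^sub>v v) / vnorm v \<le> spec_norm X"
    using pos by (simp add: vnorm_smult)
  then have "vnorm (X *\<^sub>v v) / vnorm v \<le> 1"
    using assms(1) by linarith
  then show ?thesis using pos by (simp add: field_simps)
qed

section \<open>The Moore-Penrose inverse\<close>

text \<open>With \<open>C = A * B\<close>, the hypothesis makes \<open>C\<^sup>T * C\<close> vanish,
  and its diagonal entries are the squared norms of the columns of \<open>C\<close>.\<close>

lemma gram_mult_eq_0:
  fixes A B :: "real mat"
  assumes A: "A \<in> carrier_mat nr nc" and B: "B \<in> carrier_mat nc m"
    and 0: "A\<^sup>T * (A * B) = 0\<^sub>m nc m"
  shows "A * B = 0\<^sub>m nr m"
proof -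
  define C where "C = A * B"
  have C: "C \<in> carrier_mat nr m" using A B by (simp add: C_def)
  have "C\<^sup>T * C = B\<^sup>T * (A\<^sup>T * (A * B))"
    unfolding C_def using A B by (simp add: transpose_mult[OF A B] assoc_mult_mat[of _ m nc _ nr _ m])
  also have "\<dots> = 0\<^sub>m m m" using B by (simp add: 0)
  finally have CC: "C\<^sup>T * C = 0\<^sub>m m m" .
  have "C $$ (i, j) = 0" if "i < nr" "j < m" for i j
  proof -
    have "(C\<^sup>T * C) $$ (j, j) = col C j \<bullet> col C j"
      using C that by simp
    then have "col C j \<bullet> col C j = 0" using CC that by simp
    then show ?thesis using scalar_prod_self_eq_0[of "col C j" i] C that by simp
  qed
  then show ?thesis unfolding C_def[symmetric] using C by (intro eq_matI) auto
qed

lemma row_echelon_form_inner_inverse: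
  fixes R :: "'a :: field mat"
  assumes R: "R \<in> carrier_mat nr nc" and "row_echelon_form R"
  shows "\<exists>E \<in> carrier_mat nc nr. R * E * R = R"
proof -
  obtain f where "pivot_fun R f nc"
    using assms by (auto simp: row_echelon_form_def)
  then have p: "\<And>i. i < nr \<Longrightarrow> f i \<le> nc"
    "\<And>i j. i < nr \<Longrightarrow> j < f i \<Longrightarrow> R $$ (i, j) = 0"
    "\<And>i. i < nr \<Longrightarrow> f i < nc \<Longrightarrow> R $$ (i, f i) = 1"
    "\<And>i i'. i < nr \<Longrightarrow> f i < nc \<Longrightarrow> i' < nr \<Longrightarrow> i' \<noteq> i \<Longrightarrow> R $$ (i', f i) = 0"
    using pivot_funD[of R nr f nc] R by auto
  \<comment> \<open>Column \<open>i\<close> of \<open>E\<close> selects the pivot column of row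
    \<open>i\<close>. A zero row has \<open>f i = nc\<close>, which makes its column of
    \<open>E\<close> zero, so \<open>R * E\<close> is diagonal with ones exactly at the nonzero
    rows.\<close>
  define E where "E = mat nc nr (\<lambda>(j, i). if j = f i then 1 else 0 :: 'a)"
  have E: "E \<in> carrier_mat nc nr" by (simp add: E_def)
  have RE: "(R * E) $$ (i, l) = (if f l < nc \<and> i = l then 1 else 0)" if "i < nr" "l < nr" for i l
  proof -
    have "(R * E) $$ (i, l) = (\<Sum>j\<in>{0..<nc}. R $$ (i, j) * (if j = f l then 1 else 0))"
      using that R by (simp add: E_def scalar_prod_def)
    also have "\<dots> = (\<Sum>j\<in>{0..<nc}. if j = f l then R $$ (i, j) else 0)"
      by (intro sum.cong) auto
    also have "\<dots> = (if f l < nc then R $$ (i, f l) else 0)"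
      by simp
    finally show ?thesis using p that by auto
  qed
  have "(R * E * R) $$ (i, j) = R $$ (i, j)" if "i < nr" "j < nc" for i j
  proof -
    have "(R * E * R) $$ (i, j) = (\<Sum>l\<in>{0..<nr}. (R * E) $$ (i, l) * R $$ (l, j))"
      using that R E by (simp add: scalar_prod_def del: assoc_mult_mat)
    also have "\<dots> = (\<Sum>l\<in>{0..<nr}. if l = i then (if f l < nc then R $$ (l, j) else 0) else 0)"
      using that by (intro sum.cong) (auto simp: RE)
    also have "\<dots> = (if f i < nc then R $$ (i, j) else 0)"
      using that by simp
    also have "\<dots> = R $$ (i, j)"
      using p(1,2)[of i] that by (auto simp: not_less)
    finally show ?thesis .
  qed
  then have "R * E * R = R"
    using R E by (intro eq_matI) auto
  then show ?thesis using E by blast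
qed

text \<open>Gauss-Jordan elimination gives \<open>R = P * A\<close> with \<open>Q * P = 1\<close>,
  so an inner inverse \<open>E\<close> of \<open>R\<close> transfers back:
  \<open>A * (E * P) * A = Q * (R * E * R) = Q * R = A\<close>.\<close>

lemma inner_inverse_exists:
  fixes A :: "'a :: field mat"
  assumes A: "A \<in> carrier_mat nr nc"
  shows "\<exists>M \<in> carrier_mat nc nr. A * M * A = A"
proof -
  define R where "R = gauss_jordan_single A"
  note gj = gauss_jordan_single[OF A R_def[symmetric]]
  obtain P Q where RPA: "R = P * A" and P: "P \<in> carrier_mat nr nr" and Q: "Q \<in> carrier_mat nr nr"
    and QP: "Q * P = 1\<^sub>m nr"
    using gj(4) by blast
  have R: "R \<in> carrier_mat nr nc" by (rule gj(2))
  obtain E where E: "E \<in> carrier_mat nc nr" and RER: "R * E * R = R"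
    using row_echelon_form_inner_inverse[OF R gj(3)] by blast
  have QR: "Q * R = A"
    unfolding RPA using P Q A QP by (simp flip: assoc_mult_mat)
  have "A * (E * P) * A = Q * R * (E * P) * A" by (simp only: QR)
  also have "\<dots> = Q * (R * E * (P * A))"
    using Q R E P A by (simp add: assoc_mult_mat[of _ _ nr _ nr _ nc] assoc_mult_mat[of _ _ nr _ nc _ nr]
      assoc_mult_mat[of _ _ nr _ nc _ nc] assoc_mult_mat[of _ _ nc _ nr _ nr] assoc_mult_mat[of _ _ nc _ nr _ nc])
  also have "\<dots> = A" by (simp only: RPA[symmetric] RER QR)
  finally show ?thesis using E P by (intro bexI[of _ "E * P"]) auto
qed

text \<open>Stated with dimensions in place of carriers, so that it serves as a conditional rewrite
  rule without instantiation.\<close>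

lemma mult_mat_assoc_dim:
  assumes "dim_col A = dim_row B" "dim_col B = dim_row C"
  shows "A * B * C = A * (B * (C :: 'a :: semiring_0 mat))"
  using assms by (intro assoc_mult_mat[of A "dim_row A" "dim_row B" B "dim_row C" C "dim_col C"]) auto

lemma transpose_mult_dim:
  assumes "dim_col A = dim_row B"
  shows "(A * B)\<^sup>T = B\<^sup>T * (A :: 'a :: comm_semiring_0 mat)\<^sup>T"
  using assms by (intro transpose_mult[of A "dim_row A" "dim_row B" B "dim_col B"]) auto

lemma minus_mat_eq_0_iff:
  fixes A B :: "'a :: group_add mat"
  assumes "A \<in> carrier_mat nr nc" "B \<in> carrier_mat nr nc"
  shows "A - B = 0\<^sub>m nr nc \<longleftrightarrow> A = B"
  using assms by (auto simp: mat_eq_iff)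

text \<open>The witness is \<open>M * A\<^sup>T\<close> for an inner inverse \<open>M\<close> of the
  Gram matrix \<open>A\<^sup>T * A\<close>, as in the normal equations. Since
  \<open>A\<^sup>T\<close> annihilates \<open>A * (M * N - 1)\<close>, this product is zero.\<close>

lemma least_squares_inverse_exists:
  fixes A :: "real mat"
  assumes A: "A \<in> carrier_mat nr nc"
  shows "\<exists>G \<in> carrier_mat nc nr. A * G * A = A \<and> (A * G)\<^sup>T = A * G"
proof -
  define N where "N = A\<^sup>T * A"
  have N: "N \<in> carrier_mat nc nc" using A by (simp add: N_def)
  obtain M where M: "M \<in> carrier_mat nc nc" and NMN: "N * M * N = N"
    using inner_inverse_exists[OF N] by blast
  note dims = carrier_matD[OF A] carrier_matD[OF M] carrier_matD[OF N]
  define K where "K = A * M * A\<^sup>T"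
  have K: "K \<in> carrier_mat nr nr" using A M by (simp add: K_def)
  have "A\<^sup>T * (A * (M * N - 1\<^sub>m nc)) = N * (M * N - 1\<^sub>m nc)"
    using A M N unfolding N_def by (simp add: mult_mat_assoc_dim)
  also have "\<dots> = N * M * N - N * 1\<^sub>m nc"
    using N M by (subst mult_minus_distrib_mat[of _ nc nc _ nc]) (auto simp: mult_mat_assoc_dim)
  also have "\<dots> = 0\<^sub>m nc nc"
    using N by (simp add: NMN)
  finally have "A * (M * N - 1\<^sub>m nc) = 0\<^sub>m nr nc"
    using A M N by (elim gram_mult_eq_0[rotated 2]) auto
  then have "A * (M * N) - A = 0\<^sub>m nr nc"
    using A M N by (simp add: mult_minus_distrib_mat[of _ nr nc _ nc])
  then have AMN: "A * (M * N) = A"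
    using A M N by (simp add: minus_mat_eq_0_iff[of _ nr nc])
  have KA: "K * A = A"
    using AMN dims unfolding K_def N_def by (simp add: mult_mat_assoc_dim)
  \<comment> \<open>\<open>K\<close> is symmetric even though \<open>M\<close> need not be:
    \<open>K * A = A\<close> yields \<open>K * K\<^sup>T = K\<^sup>T\<close>, whose left side equals
    its own transpose.\<close>
  have "K * K\<^sup>T = (K * A) * (M\<^sup>T * A\<^sup>T)"
    using dims unfolding K_def by (simp add: mult_mat_assoc_dim transpose_mult_dim)
  also have "\<dots> = K\<^sup>T"
    unfolding KA using dims unfolding K_def by (simp add: mult_mat_assoc_dim transpose_mult_dim)
  finally have KK: "K * K\<^sup>T = K\<^sup>T" .
  have "(K * K\<^sup>T)\<^sup>T = K * K\<^sup>T"
    using K by (simp add: transpose_mult_dim)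
  with KK have "K\<^sup>T = K" by simp
  then show ?thesis
    using KA A M dims unfolding K_def
    by (intro bexI[of _ "M * A\<^sup>T"]) (auto simp: mult_mat_assoc_dim)
qed

text \<open>The condition under the description operator of \<open>pinv\<close>, named so that
  existence and uniqueness can be proved separately.\<close>

definition moore_penrose :: "real mat \<Rightarrow> real mat \<Rightarrow> bool" where
  "moore_penrose A P \<longleftrightarrow> P \<in> carrier_mat (dim_col A) (dim_row A) \<and>
      A * P * A = A \<and> P * A * P = P \<and> (A * P)\<^sup>T = A * P \<and> (P * A)\<^sup>T = P * A"

text \<open>A least squares inverse \<open>G\<close> of \<open>A\<close> makes \<open>A * G\<close>
  symmetric, and the transpose \<open>H\<close> of one of \<open>A\<^sup>T\<close> makes
  \<open>H * A\<close> symmetric. The product \<open>P = H * A * G\<close> inherits both, since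
  \<open>A * P = A * G\<close> and \<open>P * A = H * A\<close>.\<close>

lemma moore_penrose_exists: "\<exists>P. moore_penrose A P"
proof -
  obtain G where G: "G \<in> carrier_mat (dim_col A) (dim_row A)" "A * G * A = A" "(A * G)\<^sup>T = A * G"
    using least_squares_inverse_exists[of A "dim_row A" "dim_col A"] by (meson carrier_matI)
  obtain H' where H': "H' \<in> carrier_mat (dim_row A) (dim_col A)" "A\<^sup>T * H' * A\<^sup>T = A\<^sup>T"
      "(A\<^sup>T * H')\<^sup>T = A\<^sup>T * H'"
    using least_squares_inverse_exists[of "A\<^sup>T" "dim_col A" "dim_row A"] by auto
  define H where "H = H'\<^sup>T"
  have H: "H \<in> carrier_mat (dim_col A) (dim_row A)" using H' by (simp add: H_def)
  have "(A\<^sup>T * H' * A\<^sup>T)\<^sup>T = A" by (simp add: H'(2))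
  then have AHA: "A * (H * A) = A"
    using H'(1) by (simp add: H_def transpose_mult_dim)
  have HA: "(H * A)\<^sup>T = H * A"
    using H'(1,3) by (simp add: H_def transpose_mult_dim)
  note dims = carrier_matD[OF G(1)] carrier_matD[OF H]
  define P where "P = H * (A * G)"
  have AP: "A * P = A * G"
  proof -
    have "A * P = (A * (H * A)) * G" unfolding P_def using dims by (simp add: mult_mat_assoc_dim)
    then show ?thesis by (simp add: AHA)
  qed
  have PA: "P * A = H * A"
  proof -
    have "P * A = H * (A * G * A)" unfolding P_def using dims by (simp add: mult_mat_assoc_dim)
    then show ?thesis by (simp add: G(2))
  qed
  have "P * A * P = H * (A * P)"
    unfolding PA using dims by (simp add: mult_mat_assoc_dim P_def)
  also have "\<dots> = P" unfolding AP by (simp add: P_def)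
  finally show ?thesis
    using AP PA G(2,3) HA dims unfolding moore_penrose_def
    by (intro exI[of _ P]) (auto simp: P_def)
qed

text \<open>Symmetry allows the factors of \<open>(A * Q) * (A * P)\<close> to be swapped by
  transposition, which gives \<open>A * P = A * Q\<close> and likewise \<open>P * A = Q * A\<close>.
  Then \<open>P = Q * A * P = Q * A * Q = Q\<close>.\<close>

lemma moore_penrose_unique:
  assumes P: "moore_penrose A P" and Q: "moore_penrose A Q"
  shows "P = Q"
proof -
  have p: "dim_row P = dim_col A" "dim_col P = dim_row A" "A * P * A = A" "P * A * P = P"
      "(A * P)\<^sup>T = A * P" "(P * A)\<^sup>T = P * A"
    and q: "dim_row Q = dim_col A" "dim_col Q = dim_row A" "A * Q * A = A" "Q * A * Q = Q"
      "(A * Q)\<^sup>T = A * Q" "(Q * A)\<^sup>T = Q * A"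
    using P Q by (auto simp: moore_penrose_def)
  have "A * P = (A * Q * A) * P" by (simp only: q)
  also have "\<dots> = (A * Q) * (A * P)" using p(1,2) q(1,2) by (simp add: mult_mat_assoc_dim)
  also have "\<dots> = (A * Q)\<^sup>T * (A * P)\<^sup>T" by (simp only: p q)
  also have "\<dots> = ((A * P * A) * Q)\<^sup>T"
    using p(1,2) q(1,2) by (simp add: mult_mat_assoc_dim transpose_mult_dim)
  also have "\<dots> = A * Q" by (simp only: p q)
  finally have AP: "A * P = A * Q" .
  have "P * A = P * (A * Q * A)" by (simp only: q)
  also have "\<dots> = (P * A) * (Q * A)" using p(1,2) q(1,2) by (simp add: mult_mat_assoc_dim)
  also have "\<dots> = (P * A)\<^sup>T * (Q * A)\<^sup>T" by (simp only: p q)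
  also have "\<dots> = (Q * (A * P * A))\<^sup>T"
    using p(1,2) q(1,2) by (simp add: mult_mat_assoc_dim transpose_mult_dim)
  also have "\<dots> = Q * A" by (simp only: p q)
  finally have PA: "P * A = Q * A" .
  have "P = Q * A * P" by (simp only: p flip: PA)
  also have "\<dots> = Q * (A * P)" using p(1,2) q(1,2) by (simp add: mult_mat_assoc_dim)
  also have "\<dots> = Q * A * Q" unfolding AP using p(1,2) q(1,2) by (simp add: mult_mat_assoc_dim)
  finally show ?thesis by (simp only: q)
qed

lemma pinv_eqI: "moore_penrose A P \<Longrightarrow> pinv A = P"
  unfolding pinv_def moore_penrose_def[symmetric]
  by (intro the_equality) (auto intro: moore_penrose_unique)

lemma moore_penrose_pinv: "moore_penrose A (pinv A)"
  using moore_penrose_exists pinv_eqI by metis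

section \<open>The orthogonal projection onto the null space, in the form
  \<open>1 - pinv X * X\<close>\<close>

definition null_proj :: "real mat \<Rightarrow> real vec \<Rightarrow> real vec" where
  "null_proj X v = v - pinv X *\<^sub>v (X *\<^sub>v v)"

context
  fixes X :: "real mat" and r d :: nat
  assumes X: "X \<in> carrier_mat r d"
begin

lemma pinv_carrier: "pinv X \<in> carrier_mat d r"
  using moore_penrose_pinv[of X] X by (auto simp: moore_penrose_def)

lemma null_proj_carrier [simp]: "v \<in> carrier_vec d \<Longrightarrow> null_proj X v \<in> carrier_vec d"
  using X pinv_carrier by (auto simp: null_proj_def)

lemma mult_null_proj:
  assumes v: "v \<in> carrier_vec d"
  shows "X *\<^sub>v null_proj X v = 0\<^sub>v r"
proof -
  have "X *\<^sub>v (pinv X *\<^sub>v (X *\<^sub>v v)) = (X * pinv X * X) *\<^sub>v v"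
    using X pinv_carrier v by (simp add: assoc_mult_mat_vec[of _ r r _ d] assoc_mult_mat_vec[of _ r d _ r]
      del: assoc_mult_mat)
  also have "\<dots> = X *\<^sub>v v" using moore_penrose_pinv[of X] by (simp add: moore_penrose_def)
  finally show ?thesis
    unfolding null_proj_def using X pinv_carrier v
    by (subst mult_minus_distrib_mat_vec[of _ r d]) auto
qed

lemma null_proj_eq_self:
  assumes "v \<in> carrier_vec d" "X *\<^sub>v v = 0\<^sub>v r"
  shows "null_proj X v = v"
proof -
  have "pinv X *\<^sub>v 0\<^sub>v r = 0\<^sub>v d" using pinv_carrier by (intro eq_vecI) auto
  then show ?thesis using assms by (simp add: null_proj_def)
qed

lemma null_proj_idem: "v \<in> carrier_vec d \<Longrightarrow> null_proj X (null_proj X v) = null_proj X v"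
  by (intro null_proj_eq_self mult_null_proj) auto

lemma null_proj_self_adjoint:
  assumes u: "u \<in> carrier_vec d" and v: "v \<in> carrier_vec d"
  shows "null_proj X u \<bullet> v = u \<bullet> null_proj X v"
proof -
  let ?Q = "pinv X * X"
  have Q: "?Q \<in> carrier_mat d d" using pinv_carrier X by simp
  have QT: "?Q\<^sup>T = ?Q" using moore_penrose_pinv[of X] by (simp add: moore_penrose_def)
  have assoc: "pinv X *\<^sub>v (X *\<^sub>v x) = ?Q *\<^sub>v x" if "x \<in> carrier_vec d" for x
    using pinv_carrier X that by simp
  have sym: "(?Q *\<^sub>v u) \<bullet> v = u \<bullet> (?Q *\<^sub>v v)"
    using transpose_vec_mult_scalar[OF Q v u] by (simp add: QT)
  have "?Q *\<^sub>v u \<in> carrier_vec d" "?Q *\<^sub>v v \<in> carrier_vec d" using Q u v by auto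
  then show ?thesis
    unfolding null_proj_def assoc[OF u] assoc[OF v] using u v sym
    by (simp add: minus_scalar_prod_distrib[of _ d] scalar_prod_minus_distrib[of _ d])
qed

lemma null_proj_sq:
  assumes v: "v \<in> carrier_vec d"
  shows "null_proj X v \<bullet> null_proj X v = v \<bullet> null_proj X v"
  using null_proj_self_adjoint[OF v null_proj_carrier[OF v]] null_proj_idem[OF v] by simp

lemma null_proj_pythagoras:
  assumes v: "v \<in> carrier_vec d"
  shows "(pinv X *\<^sub>v (X *\<^sub>v v)) \<bullet> (pinv X *\<^sub>v (X *\<^sub>v v)) = v \<bullet> v - null_proj X v \<bullet> null_proj X v"
proof -
  let ?p = "null_proj X v"
  have p: "?p \<in> carrier_vec d" using v by simp
  have "pinv X *\<^sub>v (X *\<^sub>v v) = v - ?p"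
    using v pinv_carrier X by (intro eq_vecI) (auto simp: null_proj_def)
  then have "(pinv X *\<^sub>v (X *\<^sub>v v)) \<bullet> (pinv X *\<^sub>v (X *\<^sub>v v)) = (v \<bullet> v - v \<bullet> ?p) - (?p \<bullet> v - ?p \<bullet> ?p)"
    using v p by (simp add: minus_scalar_prod_distrib[of _ d] scalar_prod_minus_distrib[of _ d])
  then show ?thesis using null_proj_sq[OF v] comm_scalar_prod[OF v p] by simp
qed

lemma null_proj_contraction:
  "v \<in> carrier_vec d \<Longrightarrow> null_proj X v \<bullet> null_proj X v \<le> v \<bullet> v"
  using null_proj_pythagoras[of v] scalar_prod_self_nonneg[of "pinv X *\<^sub>v (X *\<^sub>v v)"] by linarith

text \<open>\<open>X\<close> sees only the component \<open>?q\<close> of \<open>v\<close>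
  orthogonal to its null space and does not lengthen it; by Pythagoras the squared norm of
  \<open>?q\<close> is the decrement on the right. Thus the loss on a task is at most the drop in
  squared error that a step on this task would cause.\<close>

lemma sq_norm_mult_le_decrement:
  assumes v: "v \<in> carrier_vec d" and "spec_norm X \<le> 1"
  shows "(vnorm (X *\<^sub>v v))\<^sup>2 \<le> v \<bullet> v - null_proj X v \<bullet> null_proj X v"
proof -
  let ?q = "pinv X *\<^sub>v (X *\<^sub>v v)"
  have q: "?q \<in> carrier_vec d" using X pinv_carrier v by auto
  have "X *\<^sub>v v = X *\<^sub>v ?q"
  proof -
    have "X *\<^sub>v null_proj X v = X *\<^sub>v v - X *\<^sub>v ?q"
      unfolding null_proj_def using X v q by (intro mult_minus_distrib_mat_vec) auto
    then have "X *\<^sub>v v - X *\<^sub>v ?q = 0\<^sub>v r" using mult_null_proj[OF v] by simp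
    then have "(X *\<^sub>v v - X *\<^sub>v ?q) $ i = 0" if "i < r" for i using that by simp
    then show ?thesis using X by (intro eq_vecI) auto
  qed
  moreover have "vnorm (X *\<^sub>v ?q) \<le> vnorm ?q"
    using X q by (intro vnorm_mult_mat_vec_le assms(2)) auto
  ultimately have "(vnorm (X *\<^sub>v v))\<^sup>2 \<le> (vnorm ?q)\<^sup>2"
    by (intro power_mono) auto
  then show ?thesis by (simp add: vnorm_sq null_proj_pythagoras[OF v])
qed

end

section \<open>Alternating projections and forgetting\<close>

lemma iterate_carrier:
  assumes "\<And>t. dim_col (fst (S (\<tau> t))) = d"
  shows "iterate d S \<tau> t \<in> carrier_vec d"
proof (induction t)
  case (Suc t)
  have "pinv (fst (S (\<tau> (Suc t)))) \<in> carrier_mat d (dim_row (fst (S (\<tau> (Suc t)))))"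
    using assms by (intro pinv_carrier) auto
  then show ?case using Suc by (auto simp: Let_def intro!: add_carrier_vec carrier_vecI)
qed simp

lemma mult_mat_vec_uminus:
  fixes A :: "'a :: ring mat"
  assumes "dim_vec v = dim_col A"
  shows "A *\<^sub>v (- v) = - (A *\<^sub>v v)"
  by (rule eq_vecI) (simp_all add: assms)

text \<open>Since \<open>w\<close> solves every task, the residual \<open>y - X w_t\<close> is
  \<open>- X (w_t - w)\<close>, which turns the affine update into a linear projection of the
  error.\<close>

lemma iterate_error:
  assumes d: "\<And>t. dim_col (fst (S (\<tau> t))) = d" and w: "w \<in> carrier_vec d"
    and y: "\<And>t. snd (S (\<tau> t)) = fst (S (\<tau> t)) *\<^sub>v w"
  shows "iterate d S \<tau> (Suc t) - w = null_proj (fst (S (\<tau> (Suc t)))) (iterate d S \<tau> t - w)"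
proof -
  define X where "X = fst (S (\<tau> (Suc t)))"
  define v where "v = iterate d S \<tau> t"
  have v: "v \<in> carrier_vec d" using iterate_carrier[where S = S and \<tau> = \<tau>, OF d] by (simp add: v_def)
  have X: "X \<in> carrier_mat (dim_row X) d" using d by (auto simp: X_def)
  note P = pinv_carrier[OF X]
  have "X *\<^sub>v w - X *\<^sub>v v = X *\<^sub>v (w - v)"
    using X v w by (simp add: mult_minus_distrib_mat_vec)
  also have "w - v = - (v - w)" using v w by (intro eq_vecI) auto
  also have "X *\<^sub>v (- (v - w)) = - (X *\<^sub>v (v - w))"
    using w carrier_matD(2)[OF X] by (intro mult_mat_vec_uminus) simp
  finally have "X *\<^sub>v w - X *\<^sub>v v = - (X *\<^sub>v (v - w))" .
  moreover have "pinv X *\<^sub>v (- (X *\<^sub>v (v - w))) = - (pinv X *\<^sub>v (X *\<^sub>v (v - w)))"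
    using carrier_matD(2)[OF P] by (intro mult_mat_vec_uminus) simp
  ultimately have "iterate d S \<tau> (Suc t) - w = v + - (pinv X *\<^sub>v (X *\<^sub>v (v - w))) - w"
    by (simp add: Let_def y flip: X_def v_def)
  also have "\<dots> = null_proj X (v - w)"
    using v w P by (intro eq_vecI) (auto simp: null_proj_def)
  finally show ?thesis by (simp only: X_def v_def)
qed

text \<open>A projection occurs in every second step, so \<open>e t\<close> and \<open>e (t + 2)\<close> lie in the range
  of the same projection; moving projections across the inner product gives
  \<open>e t \<bullet> e (t + 2) = e (t + 1) \<bullet> e (t + 1)\<close>, and Cauchy-Schwarz yields log-convexity.\<close>

lemma alternating_projections_log_convex:
  assumes X: "\<And>t. X t \<in> carrier_mat (r t) d" and e0: "e 0 \<in> carrier_vec d"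
    and step: "\<And>t. e (Suc t) = null_proj (X (Suc t)) (e t)"
    and period: "\<And>t. X (Suc (Suc (Suc t))) = X (Suc t)"
  shows "(e (Suc (Suc t)) \<bullet> e (Suc (Suc t)))\<^sup>2
    \<le> (e (Suc t) \<bullet> e (Suc t)) * (e (Suc (Suc (Suc t))) \<bullet> e (Suc (Suc (Suc t))))"
proof -
  have e: "e t \<in> carrier_vec d" for t
    by (induction t) (auto simp: e0 step null_proj_carrier[OF X])
  let ?a = "e (Suc t)" and ?b = "e (Suc (Suc t))" and ?c = "e (Suc (Suc (Suc t)))"
  have "?a \<bullet> ?c = null_proj (X (Suc t)) ?a \<bullet> ?b"
    using null_proj_self_adjoint[OF X e e, of "Suc t" "Suc t" "Suc (Suc t)"] step[of "Suc (Suc t)"]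
    by (simp add: period)
  also have "null_proj (X (Suc t)) ?a = ?a"
    using null_proj_idem[OF X e] by (simp add: step[of t])
  also have "?a \<bullet> ?b = ?b \<bullet> ?b"
    using null_proj_sq[OF X e, of "Suc (Suc t)" "Suc t"] by (simp add: step[of "Suc t"])
  finally have "(?b \<bullet> ?b)\<^sup>2 = (?a \<bullet> ?c)\<^sup>2" by simp
  also have "\<dots> \<le> (?a \<bullet> ?a) * (?c \<bullet> ?c)"
    using carrier_vecD[OF e] by (intro scalar_prod_Cauchy_Schwarz) simp
  finally show ?thesis .
qed

lemma cyclic_2_odd [simp]: "cyclic 2 (Suc (2 * n)) = 1"
  by (simp add: cyclic_def)

lemma cyclic_2_even [simp]: "cyclic 2 (Suc (Suc (2 * n))) = 2"
  by (simp add: cyclic_def)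

lemma cyclic_2_range: "cyclic 2 t \<in> {1..2}"
  by (auto simp: cyclic_def)

lemma cyclic_2_period: "cyclic 2 (Suc (Suc (Suc t))) = cyclic 2 (Suc t)"
  by (simp add: cyclic_def)

lemma sum_cyclic_2:
  fixes f :: "nat \<Rightarrow> real"
  shows "(\<Sum>t=1..2 * n. f (cyclic 2 t)) = real n * (f 1 + f 2)"
  by (induction n) (auto simp: ring_distribs)

text \<open>The last step is on task 2 and leaves this task with zero loss; task 1 accounts for
  \<open>n\<close> of the \<open>2 * n\<close> terms, whence the factor 1/2.\<close>

lemma forgetting_cyclic_2_eq:
  assumes d: "\<And>t. dim_col (fst (S (cyclic 2 t))) = d" and w: "w \<in> carrier_vec d"
    and y: "\<And>t. snd (S (cyclic 2 t)) = fst (S (cyclic 2 t)) *\<^sub>v w" and n: "n \<ge> 1"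
  shows "forgetting d (cyclic 2) S (2 * n)
    = (vnorm (fst (S 1) *\<^sub>v (iterate d S (cyclic 2) (2 * n) - w)))\<^sup>2 / 2"
proof -
  define e where "e t = iterate d S (cyclic 2) t - w" for t
  obtain m where m: "n = Suc m" using n by (cases n) auto
  have it: "iterate d S (cyclic 2) t \<in> carrier_vec d" for t by (rule iterate_carrier[where S = S and \<tau> = "cyclic 2", OF d])
  have e: "e t \<in> carrier_vec d" for t using it w by (simp add: e_def)
  have X: "fst (S (cyclic 2 t)) \<in> carrier_mat (dim_row (fst (S (cyclic 2 t)))) d" for t
    using d by auto
  have "e (2 * n) = null_proj (fst (S 2)) (e (Suc (2 * m)))"
    using iterate_error[where S = S and \<tau> = "cyclic 2", OF d w y, of "Suc (2 * m)"] by (simp add: e_def m del: iterate.simps)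
  then have "fst (S 2) *\<^sub>v e (2 * n) = 0\<^sub>v (dim_row (fst (S 2)))"
    using mult_null_proj[OF X e, of "Suc (Suc (2 * m))"] by simp
  then have 2: "(vnorm (fst (S 2) *\<^sub>v e (2 * n)))\<^sup>2 = 0"
    by (simp add: vnorm_sq)
  have "forgetting d (cyclic 2) S (2 * n)
    = 1 / real (2 * n) * (\<Sum>t=1..2 * n. (vnorm (fst (S (cyclic 2 t)) *\<^sub>v e (2 * n)))\<^sup>2)"
    unfolding forgetting_def e_def y using mult_minus_distrib_mat_vec[OF X it w] by simp
  also have "\<dots> = 1 / real (2 * n) * (real n * ((vnorm (fst (S 1) *\<^sub>v e (2 * n)))\<^sup>2 + 0))"
    unfolding sum_cyclic_2[of "\<lambda>m. (vnorm (fst (S m) *\<^sub>v e (2 * n)))\<^sup>2"] 2 ..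
  finally show ?thesis using n by (simp add: e_def)
qed

lemma forgetting_cyclic_2_le:
  assumes S: "S \<in> collections d 2" and n: "n \<ge> 1"
  shows "forgetting d (cyclic 2) S (2 * n)
    \<le> ((real (2 * n) - 1) / real (2 * n)) ^ (2 * n - 1) / (2 * real (2 * n))"
proof -
  obtain w where w: "w \<in> carrier_vec d" "vnorm w \<le> 1" and yw: "\<forall>m\<in>{1..2}. snd (S m) = fst (S m) *\<^sub>v w"
    and task: "\<forall>m\<in>{1..2}. is_task d (S m) \<and> spec_norm (fst (S m)) \<le> 1"
    using S by (auto simp: collections_def)
  have d: "dim_col (fst (S (cyclic 2 t))) = d" for t
    using task cyclic_2_range[of t] by (auto simp: is_task_def)
  have y: "snd (S (cyclic 2 t)) = fst (S (cyclic 2 t)) *\<^sub>v w" for t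
    using yw cyclic_2_range[of t] by blast
  have X: "fst (S (cyclic 2 t)) \<in> carrier_mat (dim_row (fst (S (cyclic 2 t)))) d" for t
    using d by auto
  define e where "e t = iterate d S (cyclic 2) t - w" for t
  have step: "e (Suc t) = null_proj (fst (S (cyclic 2 (Suc t)))) (e t)" for t
    unfolding e_def by (rule iterate_error[where S = S and \<tau> = "cyclic 2", OF d w(1) y])
  have e: "e t \<in> carrier_vec d" for t
    unfolding e_def using iterate_carrier[where S = S and \<tau> = "cyclic 2", OF d] w(1) by (intro minus_carrier_vec)
  \<comment> \<open>The shift by one is essential: log-convexity requires errors in the range of a
    projection, and \<open>e 0\<close> need not be one.\<close>
  define s where "s t = e (Suc t) \<bullet> e (Suc t)" for t
  have "s 0 \<le> e 0 \<bullet> e 0"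
    unfolding s_def step by (rule null_proj_contraction[OF X e])
  also have "e 0 = - w" using w(1) by (intro eq_vecI) (auto simp: e_def)
  also have "- w \<bullet> - w = (vnorm w)\<^sup>2" by (simp add: vnorm_sq)
  also have "\<dots> \<le> 1" using w(2) by (simp add: power_le_one)
  finally have s0: "s 0 \<le> 1" .
  have convex: "(s (Suc t))\<^sup>2 \<le> s t * s (Suc (Suc t))" for t
    unfolding s_def
    by (rule alternating_projections_log_convex[of "\<lambda>t. fst (S (cyclic 2 t))", OF X e step])
      (simp add: cyclic_2_period)
  define m where "m = 2 * n - 1"
  have m: "m \<ge> 1" "2 * n = Suc m" using n by (auto simp: m_def)
  have "forgetting d (cyclic 2) S (2 * n) = (vnorm (fst (S 1) *\<^sub>v e (2 * n)))\<^sup>2 / 2"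
    unfolding e_def by (rule forgetting_cyclic_2_eq[where S = S, OF d w(1) y n])
  \<comment> \<open>Task 1 is also the next task in the cycle, so its loss is bounded by the
    decrement in step \<open>Suc (2 * n)\<close>, one step beyond the horizon.\<close>
  also have "(vnorm (fst (S 1) *\<^sub>v e (2 * n)))\<^sup>2
      \<le> e (2 * n) \<bullet> e (2 * n) - e (Suc (2 * n)) \<bullet> e (Suc (2 * n))"
    using sq_norm_mult_le_decrement[OF X e, of "Suc (2 * n)" "2 * n"] task step[of "2 * n"] by simp
  also have "\<dots> = s m - s (Suc m)" by (simp add: s_def m(2))
  also have "\<dots> \<le> (real m / (real m + 1)) ^ m / (real m + 1)"
    using s0 convex m(1) by (intro log_convex_decrement_le) (auto simp: s_def)
  finally show ?thesis
    unfolding m(2) by (simp add: algebra_simps)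
qed

section \<open>Tasks consisting of a single unit row\<close>

context
  fixes a :: "real vec" and d :: nat
  assumes a: "a \<in> carrier_vec d" and unit: "a \<bullet> a = 1"
begin

lemma mult_mat_of_row: "v \<in> carrier_vec d \<Longrightarrow> mat_of_row a *\<^sub>v v = vec 1 (\<lambda>_. a \<bullet> v)"
  using a by (intro eq_vecI) auto

lemma vnorm_mult_mat_of_row: "v \<in> carrier_vec d \<Longrightarrow> vnorm (mat_of_row a *\<^sub>v v) = \<bar>a \<bullet> v\<bar>"
  unfolding mult_mat_of_row by (simp add: vnorm_def)

lemma spec_norm_mat_of_row: "spec_norm (mat_of_row a) \<le> 1"
  unfolding spec_norm_def
proof (rule cSup_least)
  have "vnorm (0\<^sub>v d) \<le> 1" by (simp add: vnorm_def)
  then show "{vnorm (mat_of_row a *\<^sub>v v) |v. v \<in> carrier_vec (dim_col (mat_of_row a)) \<and> vnorm v \<le> 1} \<noteq> {}"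
    using a by fastforce
next
  fix x
  assume "x \<in> {vnorm (mat_of_row a *\<^sub>v v) |v. v \<in> carrier_vec (dim_col (mat_of_row a)) \<and> vnorm v \<le> 1}"
  then obtain v where v: "v \<in> carrier_vec d" "vnorm v \<le> 1" and x: "x = vnorm (mat_of_row a *\<^sub>v v)"
    using a by auto
  have "vnorm a = 1" using unit vnorm_nonneg[of a] by (simp add: power2_eq_1_iff flip: vnorm_sq)
  then show "x \<le> 1"
    using scalar_prod_le_vnorm[of a v] a v by (simp add: x vnorm_mult_mat_of_row)
qed

lemma pinv_mat_of_row: "pinv (mat_of_row a) = (mat_of_row a)\<^sup>T"
proof (rule pinv_eqI)
  let ?A = "mat_of_row a"
  have A: "?A \<in> carrier_mat 1 d" using a by auto
  have 1: "?A * ?A\<^sup>T = 1\<^sub>m 1"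
    using a unit by (intro eq_matI) auto
  have "?A\<^sup>T * ?A * ?A\<^sup>T = ?A\<^sup>T * (?A * ?A\<^sup>T)" using A by (simp add: mult_mat_assoc_dim)
  then show "moore_penrose ?A ?A\<^sup>T"
    unfolding moore_penrose_def 1 using A by (simp add: transpose_mult_dim 1 del: assoc_mult_mat)
qed

lemma null_proj_mat_of_row:
  assumes v: "v \<in> carrier_vec d"
  shows "null_proj (mat_of_row a) v = v - (a \<bullet> v) \<cdot>\<^sub>v a"
proof -
  have "(mat_of_row a)\<^sup>T *\<^sub>v vec 1 (\<lambda>_. a \<bullet> v) = (a \<bullet> v) \<cdot>\<^sub>v a"
    using a by (intro eq_vecI) (auto simp: scalar_prod_def)
  then show ?thesis
    by (simp add: null_proj_def mult_mat_of_row[OF v] pinv_mat_of_row)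
qed

lemma mrank_mat_of_row: "mrank (mat_of_row a) \<le> 1"
  unfolding mrank_def
  by (rule vec_space.rank_le_1_product_entries[where nc = d and f = "\<lambda>_. 1" and g = "($) a"])
    (use a in auto)

end

lemma scalar_prod_plane:
  fixes a0 a1 b0 b1 :: real
  assumes "d \<ge> 2"
  shows "vec d (\<lambda>i. if i = 0 then a0 else if i = 1 then a1 else 0)
    \<bullet> vec d (\<lambda>i. if i = 0 then b0 else if i = 1 then b1 else 0) = a0 * b0 + a1 * b1"
proof -
  have "(\<Sum>i\<in>{0..<d}. (if i = 0 then a0 else if i = 1 then a1 else 0) *
      (if i = 0 then b0 else if i = 1 then b1 else 0)) = (\<Sum>i\<in>{0, 1::nat}. (if i = 0 then a0 else if i = 1 then a1 else 0) *
      (if i = 0 then b0 else if i = 1 then b1 else 0))"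
    using assms by (intro sum.mono_neutral_right) auto
  then show ?thesis by (simp add: scalar_prod_def)
qed

text \<open>Two unit rows in a coordinate plane whose null spaces meet the plane in lines at angle
  \<open>\<theta>\<close>, with \<open>c = cos \<theta>\<close> and \<open>s = sin \<theta>\<close>.\<close>

lemma forgetting_two_lines:
  fixes c s :: real
  assumes d: "d \<ge> 2" and cs: "c\<^sup>2 + s\<^sup>2 = 1" and n: "n \<ge> 1"
  shows "\<exists>S \<in> collections d 2. forgetting d (cyclic 2) S (2 * n) = (c\<^sup>2) ^ (2 * n - 1) * s\<^sup>2 / 2"
proof -
  define pl where "pl x y = vec d (\<lambda>i. if i = 0 then x else if i = 1 then y else 0)" for x y :: real
  have pl: "pl x y \<in> carrier_vec d" for x y by (simp add: pl_def)
  have sp: "pl x y \<bullet> pl x' y' = x * x' + y * y'" for x y x' y'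
    unfolding pl_def by (rule scalar_prod_plane[OF d])
  have lin: "pl x y - r \<cdot>\<^sub>v pl x' y' = pl (x - r * x') (y - r * y')" for x y x' y' r
    by (intro eq_vecI) (auto simp: pl_def)
  \<comment> \<open>Within the plane the rows are normals to the lines spanned by
    \<open>pl 1 0\<close> and \<open>pl c s\<close>.\<close>
  define a where "a m = (if m = 1 then pl 0 1 else pl (- s) c)" for m :: nat
  \<comment> \<open>The target lies in the null space of the first row, so the first step loses none
    of the initial error.\<close>
  define w where "w = pl 1 0"
  define S where "S m = (mat_of_row (a m), mat_of_row (a m) *\<^sub>v w)" for m :: nat
  have a: "a m \<in> carrier_vec d" "a m \<bullet> a m = 1" for m
    using cs by (auto simp: a_def pl sp power2_eq_square)
  have w: "w \<in> carrier_vec d" by (simp add: w_def pl)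
  have "mrank (mat_of_row (a m)) < d" for m
    using mrank_mat_of_row[OF a] d by (meson le_less_trans less_le_trans one_less_numeral_iff semiring_norm(76))
  moreover have "vnorm w \<le> 1"
    using vnorm_sq[of w] vnorm_nonneg[of w] by (auto simp: w_def sp power2_eq_1_iff)
  ultimately have mem: "S \<in> collections d 2"
    using a w spec_norm_mat_of_row[OF a] by (auto simp: collections_def is_task_def S_def)
  have dS: "dim_col (fst (S (cyclic 2 t))) = d" for t using a(1) by (simp add: S_def)
  have yS: "snd (S (cyclic 2 t)) = fst (S (cyclic 2 t)) *\<^sub>v w" for t by (simp add: S_def)
  define e where "e t = iterate d S (cyclic 2) t - w" for t
  have step: "e (Suc t) = e t - (a (cyclic 2 (Suc t)) \<bullet> e t) \<cdot>\<^sub>v a (cyclic 2 (Suc t))"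
    if "e t \<in> carrier_vec d" for t
    using iterate_error[where S = S and \<tau> = "cyclic 2", OF dS w yS, of t] null_proj_mat_of_row[OF a that]
    by (simp add: e_def S_def del: iterate.simps)
  \<comment> \<open>The error on the first line is projected onto the direction
    \<open>pl c s\<close>. The next step keeps only its first coordinate, so a full cycle contracts
    the error by \<open>c\<^sup>2\<close>.\<close>
  have even_step: "e (Suc (Suc (2 * j))) = pl (- ((c\<^sup>2) ^ Suc j)) (- ((c\<^sup>2) ^ j * (s * c)))"
    if "e (Suc (2 * j)) = pl (- ((c\<^sup>2) ^ j)) 0" for j
  proof -
    have "e (Suc (Suc (2 * j))) = pl (- ((c\<^sup>2) ^ j) - s * (c\<^sup>2) ^ j * - s) (0 - s * (c\<^sup>2) ^ j * c)"
      using step[of "Suc (2 * j)"] that by (simp add: pl a_def sp lin)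
    also have "- ((c\<^sup>2) ^ j) - s * (c\<^sup>2) ^ j * - s = - ((c\<^sup>2) ^ j) * (1 - s\<^sup>2)"
      by (simp add: algebra_simps power2_eq_square)
    also have "1 - s\<^sup>2 = c\<^sup>2" using cs by linarith
    finally show ?thesis by (simp add: ac_simps)
  qed
  have odd: "e (Suc (2 * j)) = pl (- ((c\<^sup>2) ^ j)) 0" for j
  proof (induction j)
    case 0
    have "e 0 = pl (- 1) 0" by (intro eq_vecI) (auto simp: e_def w_def pl_def)
    then show ?case using step[of 0] cyclic_2_odd[of 0] by (simp add: pl a_def sp lin)
  next
    case (Suc j)
    have "Suc (Suc (2 * j)) = 2 * Suc j" by simp
    then show ?case
      using step[of "2 * Suc j"] cyclic_2_odd[of "Suc j"] even_step[OF Suc.IH]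
      by (simp add: pl a_def sp lin)
  qed
  obtain j where j: "n = Suc j" using n by (cases n) auto
  have e2n: "e (2 * n) = pl (- ((c\<^sup>2) ^ Suc j)) (- ((c\<^sup>2) ^ j * (s * c)))"
    using even_step[OF odd, of j] by (simp add: j)
  have "forgetting d (cyclic 2) S (2 * n) = (vnorm (mat_of_row (a 1) *\<^sub>v e (2 * n)))\<^sup>2 / 2"
    using forgetting_cyclic_2_eq[where S = S, OF dS w yS n] by (simp add: e_def S_def)
  also have "\<dots> = (a 1 \<bullet> e (2 * n))\<^sup>2 / 2"
    using vnorm_mult_mat_of_row[OF a, of "e (2 * n)"] by (simp add: e2n pl)
  also have "a 1 \<bullet> e (2 * n) = - ((c\<^sup>2) ^ j * (s * c))"
    by (simp add: e2n a_def sp)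
  also have "(- ((c\<^sup>2) ^ j * (s * c)))\<^sup>2 = (c\<^sup>2) ^ (2 * n - 1) * s\<^sup>2"
  proof -
    have "2 * n - 1 = Suc (2 * j)" by (simp add: j)
    then have "(c\<^sup>2) ^ (2 * n - 1) = c\<^sup>2 * ((c\<^sup>2) ^ j)\<^sup>2"
      by (simp only: power_Suc power_even_eq)
    then show ?thesis by (simp only: power2_minus power_mult_distrib mult_ac)
  qed
  finally show ?thesis using mem by blast
qed

section \<open>The exact supremum and its expansion\<close>

lemma SUP_forgetting_cyclic_2:
  assumes d: "d \<ge> 2" and n: "n \<ge> 1"
  shows "(SUP S \<in> collections d 2. forgetting d (cyclic 2) S (2 * n))
    = ((real (2 * n) - 1) / real (2 * n)) ^ (2 * n - 1) / (2 * real (2 * n))" (is "_ = ?G")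
proof -
  define k where "k = real (2 * n)"
  have k: "k \<ge> 2" using n by (simp add: k_def)
  \<comment> \<open>The squared cosine is the maximiser \<open>m / (m + 1)\<close> of
    \<open>x ^ m * (1 - x)\<close> for \<open>m = k - 1\<close>.\<close>
  have "(sqrt ((k - 1) / k))\<^sup>2 + (sqrt (1 / k))\<^sup>2 = 1"
    using k by (simp add: field_simps)
  then obtain S where S: "S \<in> collections d 2"
    and "forgetting d (cyclic 2) S (2 * n) = ((sqrt ((k - 1) / k))\<^sup>2) ^ (2 * n - 1) * (sqrt (1 / k))\<^sup>2 / 2"
    using forgetting_two_lines[OF d _ n] by blast
  then have "forgetting d (cyclic 2) S (2 * n) = ((k - 1) / k) ^ (2 * n - 1) / (2 * k)"
    using k by simp
  then have attained: "forgetting d (cyclic 2) S (2 * n) = ?G" by (simp only: k_def)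
  show ?thesis
  proof (rule cSup_eq_maximum)
    show "?G \<in> (\<lambda>S. forgetting d (cyclic 2) S (2 * n)) ` collections d 2"
      using S attained by (metis image_eqI)
  qed (use forgetting_cyclic_2_le[OF _ n] in blast)
qed

theorem mainTheorem5:
  fixes d :: nat
  assumes "d \<ge> 2"
  shows "\<exists>C. \<forall>n::nat. n \<ge> 1 \<longrightarrow>
    (let k = 2 * n in
      \<bar>(SUP S \<in> collections d 2. forgetting d (cyclic 2) S k)
        - (1 / (2 * exp 1 * (real k - 1)) - 1 / (4 * exp 1 * (real k - 1)^2))\<bar>
      \<le> C / real k ^ 3)"
proof -
  \<comment> \<open>The same constant serves every dimension \<open>d \<ge> 2\<close>, because the
    supremum depends on \<open>n\<close> alone.\<close>
  obtain C where C: "\<forall>k\<ge>2. \<bar>((real k - 1) / real k) ^ (k - 1) / (2 * real k)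
     - (1 / (2 * exp 1 * (real k - 1)) - 1 / (4 * exp 1 * (real k - 1)\<^sup>2))\<bar> \<le> C / real k ^ 3"
    using extremal_value_expansion by blast
  have "\<bar>(SUP S \<in> collections d 2. forgetting d (cyclic 2) S (2 * n))
        - (1 / (2 * exp 1 * (real (2 * n) - 1)) - 1 / (4 * exp 1 * (real (2 * n) - 1)^2))\<bar>
      \<le> C / real (2 * n) ^ 3" if "n \<ge> 1" for n
    unfolding SUP_forgetting_cyclic_2[OF assms that] using C[rule_format, of "2 * n"] that by simp
  then show ?thesis unfolding Let_def by blast
qed

end
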